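(* For every $n\ge1$ and any two permutations $\pi_1,\pi_2$ of $[n]=\{1,\dots,n\}$, $$\frac18\,\rho_{\mathrm r}(\pi_1,\pi_2)^2\le \rho_{\mathrm{EMD}}(\pi_1,\pi_2)\le 48\,\rho_{\mathrm r}(\pi_1,\pi_2)^{1/2},$$ where $\rho_{\mathrm r}$ is the rectangular distance and $\rho_{\mathrm{EMD}}$ is the earth mover's distance.
   Context: A permutation of length $n$ is a bijection $[n]\to[n]$. The rectangular (cut) distance is $$\rho_{\mathrm r}(\pi_1,\pi_2)=\frac1n\max_{S,T}\bigl||\pi_1(S)\cap T|-|\pi_2(S)\cap T|\bigr|,$$ the maximum being over all subintervals $S,T$ of $[n]$ (sets of consecutive integers). The earth mover's distance is $$\rho_{\mathrm{EMD}}(\pi_1,\pi_2)=\frac{1}{\binom n2}\min_{\theta}\sum_{i=1}^n\bigl(|i-\theta(i)|+|\pi_1(i)-\pi_2(\theta(i))|\bigr),$$ the minimum being over all bijections $\theta:[n]\to[n]$. For $n=1$ all distances are $0$ by convention. *)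

theory Defs
  imports Complex_Main "HOL-Combinatorics.Permutations"
begin

(* [n] is {1..n}, and a permutation of length n is a function p with p permutes {1..n}:
   a bijection of {1..n}, extended by the identity outside {1..n}. *)

(* The empty interval is allowed; it contributes 0 to the maximum in rho_r below. *)
definition subintervals :: "nat \<Rightarrow> nat set set" where
  "subintervals n = {{a..b} | a b. {a..b} \<subseteq> {1..n}}"

definition rho_r :: "nat \<Rightarrow> (nat \<Rightarrow> nat) \<Rightarrow> (nat \<Rightarrow> nat) \<Rightarrow> real" where
  "rho_r n p1 p2 =
    (if n = 1 then 0
     else 1 / real n *
       Max {\<bar>real (card (p1 ` S \<inter> T)) - real (card (p2 ` S \<inter> T))\<bar> | S T.
              S \<in> subintervals n \<and> T \<in> subintervals n})"

definition rho_EMD :: "nat \<Rightarrow> (nat \<Rightarrow> nat) \<Rightarrow> (nat \<Rightarrow> nat) \<Rightarrow> real" where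
  "rho_EMD n p1 p2 =
    (if n = 1 then 0
     else 1 / real (n choose 2) *
       Min {(\<Sum>i=1..n. \<bar>real i - real (\<theta> i)\<bar> + \<bar>real (p1 i) - real (p2 (\<theta> i))\<bar>) | \<theta>.
              \<theta> permutes {1..n}})"

(* The sets under Max and Min are finite and nonempty, so both extrema are attained. *)

lemma finite_subintervals: "finite (subintervals n)"
  by (rule finite_subset[of _ "Pow {1..n}"]) (auto simp: subintervals_def)

lemma rho_r_values:
  fixes f :: "nat set \<Rightarrow> nat set \<Rightarrow> real"
  shows "finite {f S T | S T. S \<in> subintervals n \<and> T \<in> subintervals n}"
    and "{f S T | S T. S \<in> subintervals n \<and> T \<in> subintervals n} \<noteq> {}"
proof -
  show "finite {f S T | S T. S \<in> subintervals n \<and> T \<in> subintervals n}"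
    by (rule finite_image_set2) (simp_all add: finite_subintervals)
  have "{1..0} \<in> subintervals n"
    unfolding subintervals_def by fastforce
  then show "{f S T | S T. S \<in> subintervals n \<and> T \<in> subintervals n} \<noteq> {}"
    by blast
qed

lemma rho_EMD_values:
  fixes f :: "(nat \<Rightarrow> nat) \<Rightarrow> real"
  shows "finite {f \<theta> | \<theta>. \<theta> permutes {1..n}}"
    and "{f \<theta> | \<theta>. \<theta> permutes {1..n}} \<noteq> {}"
proof -
  show "finite {f \<theta> | \<theta>. \<theta> permutes {1..n}}"
    by (rule finite_image_set) (simp add: finite_permutations)
  show "{f \<theta> | \<theta>. \<theta> permutes {1..n}} \<noteq> {}"
    using permutes_id by blast
qed

end

theory Submission
  imports Defs "HOL-Library.Infinite_Set"
begin

text \<open>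
  Lower bound: let \<open>D\<close> be the discrepancy of \<open>S \<times> T\<close>. Any matching \<open>\<theta>\<close> moves at least \<open>D\<close> points
  across the boundary of \<open>S \<times> T\<close>, and at most \<open>4j\<close> of these start within distance \<open>j\<close> of the
  complement. Taking \<open>j = D div 8\<close>, at least \<open>D/2\<close> points travel more than \<open>D/8\<close>.

  Upper bound: cut \<open>[n]\<close> into strips of width about \<open>sqrt (n D)\<close> and match the points of each
  vertical strip in increasing order of height. The horizontal cost is at most \<open>n sqrt (n D)\<close>.
  The vertical cost inside a strip \<open>S\<close> is the \<open>L\<^sup>1\<close> distance of the two counting functions
  \<open>t \<mapsto> |\<pi>(S) \<inter> [t]|\<close>, each value of which is a rectangle discrepancy; so it is at most \<open>n D\<close>.
\<close>

section \<open>Lower bound for the cost of moving a finite configuration of points\<close>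

lemma card_near_complement_le:
  fixes x x' :: "'i \<Rightarrow> nat"
  assumes "finite I" and "inj_on x I"
  shows "card {i \<in> I. x i \<in> {a..b} \<and> x' i \<notin> {a..b} \<and> \<bar>real (x i) - real (x' i)\<bar> \<le> real j}
    \<le> 2 * j" (is "card ?M \<le> _")
proof -
  \<comment> \<open>A point that leaves \<open>{a..b}\<close> by a move of length at most
    \<open>j\<close> starts among the \<open>j\<close> lowest or the \<open>j\<close> highest
    integers of the interval. Truncation in \<open>b + 1 - j\<close> is harmless: the second block
    still has at most \<open>j\<close> elements.\<close>
  have sub: "x ` ?M \<subseteq> {a..<a + j} \<union> {b + 1 - j..b}"
    by (auto simp: abs_le_iff)
  have "card ?M = card (x ` ?M)"
    by (rule card_image[symmetric]) (rule inj_on_subset[OF assms(2)], auto)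
  also have "\<dots> \<le> card ({a..<a + j} \<union> {b + 1 - j..b})"
    by (rule card_mono[OF _ sub]) simp
  also have "\<dots> \<le> card {a..<a + j} + card {b + 1 - j..b}"
    by (rule card_Un_le)
  also have "\<dots> \<le> 2 * j"
    by simp
  finally show ?thesis .
qed

text \<open>At least \<open>D\<close> indices lie in \<open>A - B\<close>: they start inside the
  rectangle and end outside. The hypothesis is one-sided so that \<open>D\<close> is a natural
  number to which \<open>div\<close> applies.\<close>

lemma transport_cost_ge_crossing:
  fixes x y x' y' :: "'i \<Rightarrow> nat"
  assumes fin: "finite I" and "inj_on x I" and "inj_on y I"
    and D: "D + card {i \<in> I. x' i \<in> {a..b} \<and> y' i \<in> {c..d}}
        \<le> card {i \<in> I. x i \<in> {a..b} \<and> y i \<in> {c..d}}"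
  shows "(real D)\<^sup>2 / 16
    \<le> (\<Sum>i\<in>I. \<bar>real (x i) - real (x' i)\<bar> + \<bar>real (y i) - real (y' i)\<bar>)"
proof -
  define cost where
    "cost i = \<bar>real (x i) - real (x' i)\<bar> + \<bar>real (y i) - real (y' i)\<bar>" for i
  define A where "A = {i \<in> I. x i \<in> {a..b} \<and> y i \<in> {c..d}}"
  define B where "B = {i \<in> I. x' i \<in> {a..b} \<and> y' i \<in> {c..d}}"
  define j where "j = D div 8"
  define N where "N = {i \<in> A - B. cost i \<le> real j}"
  define L where "L = {i \<in> A - B. \<not> cost i \<le> real j}"
  have finA: "finite A" and finB: "finite B" and finN: "finite N" and finL: "finite L"
    using fin by (auto simp: A_def B_def N_def L_def)
  let ?X = "{i \<in> I. x i \<in> {a..b} \<and> x' i \<notin> {a..b} \<and> \<bar>real (x i) - real (x' i)\<bar> \<le> real j}"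
  let ?Y = "{i \<in> I. y i \<in> {c..d} \<and> y' i \<notin> {c..d} \<and> \<bar>real (y i) - real (y' i)\<bar> \<le> real j}"
  \<comment> \<open>A crossing point must leave the rectangle in one of the two coordinates, and its
    displacement in that coordinate is at most its total cost.\<close>
  have "card N \<le> card (?X \<union> ?Y)"
    using fin by (intro card_mono) (auto simp: N_def A_def B_def cost_def)
  also have "\<dots> \<le> card ?X + card ?Y"
    by (rule card_Un_le)
  also have "\<dots> \<le> 4 * j"
    using card_near_complement_le[OF fin assms(2), of a b x' j]
      card_near_complement_le[OF fin assms(3), of c d y' j] by linarith
  finally have N: "card N \<le> 4 * j" .
  have "card A \<le> card (N \<union> L \<union> B)"
    using finN finL finB by (intro card_mono) (auto simp: N_def L_def)
  also have "\<dots> \<le> card N + card L + card B"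
    by (meson add_le_mono1 card_Un_le order_trans)
  finally have "D \<le> 4 * j + card L"
    using D N unfolding A_def[symmetric] B_def[symmetric] by linarith
  moreover have "8 * j \<le> D"
    unfolding j_def by simp
  ultimately have L: "real D / 2 \<le> real (card L)"
    by linarith
  have "D \<le> 8 * j + 8"
    unfolding j_def by presburger
  then have "real D \<le> real (8 * j + 8)"
    by (rule of_nat_mono)
  then have j: "real D / 8 \<le> real j + 1"
    by simp
  \<comment> \<open>Costs are integers, so exceeding \<open>j\<close> means being at least
    \<open>j + 1\<close>. This recovers what rounding lost in \<open>D div 8\<close>, since
    \<open>j + 1\<close> is at least \<open>D / 8\<close>.\<close>
  have step: "real j + 1 \<le> cost i" if i: "i \<in> L" for i
  proof -
    obtain c :: int where c: "cost i = real_of_int c"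
      by (rule that[of "\<bar>int (x i) - int (x' i)\<bar> + \<bar>int (y i) - int (y' i)\<bar>"])
        (simp add: cost_def)
    have "\<not> cost i \<le> real j"
      using i by (simp add: L_def)
    then have "int j + 1 \<le> c"
      unfolding c by (metis of_int_le_iff of_int_of_nat_eq not_le zless_imp_add1_zle)
    then have "real_of_int (int j + 1) \<le> real_of_int c"
      by (simp only: of_int_le_iff)
    then show ?thesis
      by (simp add: c)
  qed
  have "(real D)\<^sup>2 / 16 = (real D / 2) * (real D / 8)"
    by (simp add: power2_eq_square)
  also have "\<dots> \<le> real (card L) * (real j + 1)"
    using L j by (intro mult_mono) auto
  also have "\<dots> \<le> (\<Sum>i\<in>L. cost i)"
    using step by (intro sum_bounded_below[where K = "real j + 1", simplified]) auto
  also have "\<dots> \<le> (\<Sum>i\<in>I. cost i)"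
    using fin by (intro sum_mono2) (auto simp: L_def A_def cost_def)
  finally show ?thesis
    unfolding cost_def .
qed

text \<open>If the rectangle holds more targets than sources, the two configurations exchange roles;
  the cost is symmetric.\<close>

lemma transport_cost_ge_discrepancy:
  fixes x y x' y' :: "'i \<Rightarrow> nat"
  assumes fin: "finite I" and "inj_on x I" and "inj_on y I" and "inj_on x' I" and "inj_on y' I"
  shows "(real (card {i \<in> I. x i \<in> {a..b} \<and> y i \<in> {c..d}})
      - real (card {i \<in> I. x' i \<in> {a..b} \<and> y' i \<in> {c..d}}))\<^sup>2 / 16
    \<le> (\<Sum>i\<in>I. \<bar>real (x i) - real (x' i)\<bar> + \<bar>real (y i) - real (y' i)\<bar>)"
    (is "(real ?p - real ?q)\<^sup>2 / 16 \<le> _")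
proof (cases "?q \<le> ?p")
  case True
  then show ?thesis
    using transport_cost_ge_crossing[OF fin assms(2,3), of "?p - ?q" x' a b y' c d]
    by (simp add: of_nat_diff)
next
  case False
  have "(real ?q - real ?p)\<^sup>2 / 16
      \<le> (\<Sum>i\<in>I. \<bar>real (x' i) - real (x i)\<bar> + \<bar>real (y' i) - real (y i)\<bar>)"
    using transport_cost_ge_crossing[OF fin assms(4,5), of "?q - ?p" x a b y c d] False
    by (simp add: of_nat_diff)
  then show ?thesis
    by (simp add: power2_commute abs_minus_commute)
qed

section \<open>Order-preserving matching of two point sets on a line\<close>

lemma abs_diff_eq_sum_thresholds:
  fixes a b n :: nat
  assumes "1 \<le> a" "1 \<le> b" "a \<le> n" "b \<le> n"
  shows "\<bar>real a - real b\<bar> = (\<Sum>t=1..n. of_bool ((a \<le> t) \<noteq> (b \<le> t)))"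
proof -
  have "{t \<in> {1..n}. (a \<le> t) \<noteq> (b \<le> t)} = {min a b..<max a b}"
    using assms by auto
  then have "(\<Sum>t=1..n. of_bool ((a \<le> t) \<noteq> (b \<le> t))) = real (card {min a b..<max a b})"
    by (simp add: of_bool_def sum.If_cases Int_def conj_commute)
  then show ?thesis
    by (simp add: min_def max_def)
qed

text \<open>Each distance counts the thresholds \<open>t\<close> that separate its two points. After
  exchanging the sums, a fixed \<open>t\<close> contributes a symmetric difference of two nested
  index sets, whose size is exactly the difference of their cardinalities.\<close>

lemma sum_abs_diff_strict_mono_le:
  fixes a b :: "nat \<Rightarrow> nat"
  assumes a: "strict_mono_on {..<k} a" "a ` {..<k} \<subseteq> {1..n}"
    and b: "strict_mono_on {..<k} b" "b ` {..<k} \<subseteq> {1..n}"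
    and disc: "\<And>t. t \<in> {1..n} \<Longrightarrow>
      \<bar>real (card {i. i < k \<and> a i \<le> t}) - real (card {i. i < k \<and> b i \<le> t})\<bar> \<le> D"
  shows "(\<Sum>i<k. \<bar>real (a i) - real (b i)\<bar>) \<le> real n * D"
proof -
  have "(\<Sum>i<k. \<bar>real (a i) - real (b i)\<bar>)
      = (\<Sum>i<k. \<Sum>t=1..n. of_bool ((a i \<le> t) \<noteq> (b i \<le> t)))"
    using a(2) b(2) by (intro sum.cong refl abs_diff_eq_sum_thresholds) auto
  also have "\<dots> = (\<Sum>t=1..n. \<Sum>i<k. of_bool ((a i \<le> t) \<noteq> (b i \<le> t)))"
    by (rule sum.swap)
  also have "\<dots> \<le> (\<Sum>t=1..n. D)"
  proof (rule sum_mono)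
    fix t assume t: "t \<in> {1..n}"
    let ?A = "{i. i < k \<and> a i \<le> t}" and ?B = "{i. i < k \<and> b i \<le> t}"
    have down: "i \<in> {i. i < k \<and> f i \<le> t}"
      if "strict_mono_on {..<k} f" "i < j" "j \<in> {i. i < k \<and> f i \<le> t}"
      for f :: "nat \<Rightarrow> nat" and i j
      using strict_mono_onD[OF that(1), of i j] that(2,3) by auto
    \<comment> \<open>Both are initial segments of \<open>{..<k}\<close>.\<close>
    have nested: "?A \<subseteq> ?B \<or> ?B \<subseteq> ?A"
    proof (rule ccontr)
      assume "\<not> (?A \<subseteq> ?B \<or> ?B \<subseteq> ?A)"
      then obtain i j where "i \<in> ?A" "i \<notin> ?B" "j \<in> ?B" "j \<notin> ?A"
        by blast
      then show False
        using down[OF b(1), of i j] down[OF a(1), of j i] by (metis linorder_less_linear)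
    qed
    have "{i \<in> {..<k}. (a i \<le> t) \<noteq> (b i \<le> t)} = (?A - ?B) \<union> (?B - ?A)"
      by auto
    then have "(\<Sum>i<k. of_bool ((a i \<le> t) \<noteq> (b i \<le> t))) = real (card ((?A - ?B) \<union> (?B - ?A)))"
      by (simp add: of_bool_def sum.If_cases Int_def conj_commute)
    also have "\<dots> = \<bar>real (card ?A) - real (card ?B)\<bar>"
      using nested
    proof
      assume *: "?A \<subseteq> ?B"
      then have "(?A - ?B) \<union> (?B - ?A) = ?B - ?A" by blast
      then show ?thesis
        using * card_mono[OF _ *] by (simp add: card_Diff_subset of_nat_diff)
    next
      assume *: "?B \<subseteq> ?A"
      then have "(?A - ?B) \<union> (?B - ?A) = ?A - ?B" by blast
      then show ?thesis
        using * card_mono[OF _ *] by (simp add: card_Diff_subset of_nat_diff)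
    qed
    also have "\<dots> \<le> D"
      by (rule disc[OF t])
    finally show "(\<Sum>i<k. of_bool ((a i \<le> t) \<noteq> (b i \<le> t))) \<le> D" .
  qed
  finally show ?thesis
    by simp
qed

lemma monotone_matching:
  fixes p q :: "'i \<Rightarrow> nat"
  assumes fin: "finite S" and p: "inj_on p S" "p ` S \<subseteq> {1..n}" and q: "inj_on q S" "q ` S \<subseteq> {1..n}"
    and disc: "\<And>t. t \<in> {1..n} \<Longrightarrow>
      \<bar>real (card (p ` S \<inter> {1..t})) - real (card (q ` S \<inter> {1..t}))\<bar> \<le> D"
  obtains g where "bij_betw g S S" "(\<Sum>i\<in>S. \<bar>real (p i) - real (q (g i))\<bar>) \<le> real n * D"
proof -
  define k where "k = card S"
  have cp: "card (p ` S) = k" and cq: "card (q ` S) = k"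
    unfolding k_def by (rule card_image, fact)+
  obtain a where a: "bij_betw a {..<k} (p ` S)" "strict_mono_on {..<k} a"
    using ex_bij_betw_strict_mono_card[of "p ` S"] fin cp by auto
  obtain b where b: "bij_betw b {..<k} (q ` S)" "strict_mono_on {..<k} b"
    using ex_bij_betw_strict_mono_card[of "q ` S"] fin cq by auto
  have bp: "bij_betw p S (p ` S)" and bq: "bij_betw q S (q ` S)"
    using p q by (simp_all add: bij_betw_def)
  \<comment> \<open>\<open>r i\<close> is the rank of \<open>p i\<close> in \<open>p\<close>
    S\<open>, counted from 0;\<close>g
    i\<open>is the element of\<close>S\<open>whose\<close>q\<open>-value has the same rank in\<close>q
    \<open>S\<close>.\<close>
  define r where "r = inv_into {..<k} a \<circ> p"
  define g where "g = inv_into S q \<circ> b \<circ> r"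
  have r: "bij_betw r S {..<k}"
    unfolding r_def by (rule bij_betw_trans[OF bp bij_betw_inv_into[OF a(1)]])
  have g: "bij_betw g S S"
    unfolding g_def comp_assoc
    by (rule bij_betw_trans[OF bij_betw_trans[OF r b(1)] bij_betw_inv_into[OF bq]])
  have ar: "a (r i) = p i" if "i \<in> S" for i
    using bij_betw_inv_into_right[OF a(1)] that by (simp add: r_def)
  have br: "q (g i) = b (r i)" if "i \<in> S" for i
    using bij_betw_inv_into_right[OF bq] bij_betwE[OF b(1)] bij_betwE[OF r] that
    by (simp add: g_def)
  \<comment> \<open>This translates the hypothesis on images into one on the sorted enumerations.
    The window starts at 1 so that it is a subinterval of [n], as the rectangular distance
    requires.\<close>
  have count: "card {i. i < k \<and> f i \<le> t} = card (h ` S \<inter> {1..t})"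
    if f: "bij_betw f {..<k} (h ` S)" and h: "h ` S \<subseteq> {1..n}" for f :: "nat \<Rightarrow> nat" and h :: "'i \<Rightarrow> nat" and t
  proof -
    have "f ` {i. i < k \<and> f i \<le> t} = f ` {..<k} \<inter> {..t}"
      by blast
    also have "\<dots> = h ` S \<inter> {..t}"
      unfolding bij_betw_imp_surj_on[OF f] ..
    also have "\<dots> = h ` S \<inter> {1..t}"
      using h by fastforce
    finally have "f ` {i. i < k \<and> f i \<le> t} = h ` S \<inter> {1..t}" .
    moreover have "inj_on f {i. i < k \<and> f i \<le> t}"
      by (rule inj_on_subset[OF bij_betw_imp_inj_on[OF f]]) auto
    ultimately show ?thesis
      using card_image[of f "{i. i < k \<and> f i \<le> t}"] by simp
  qed
  have "(\<Sum>i\<in>S. \<bar>real (p i) - real (q (g i))\<bar>) = (\<Sum>i\<in>S. \<bar>real (a (r i)) - real (b (r i))\<bar>)"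
    by (simp add: ar br)
  also have "\<dots> = (\<Sum>i<k. \<bar>real (a i) - real (b i)\<bar>)"
    by (rule sum.reindex_bij_betw[OF r])
  also have "\<dots> \<le> real n * D"
    using disc unfolding count[OF a(1) p(2), symmetric] count[OF b(1) q(2), symmetric]
    by (intro sum_abs_diff_strict_mono_le a(2) b(2))
      (use bij_betw_imp_surj_on[OF a(1)] bij_betw_imp_surj_on[OF b(1)] p(2) q(2) in auto)
  finally show thesis
    using that g by blast
qed

section \<open>Elementary bounds for the rectangular distance and the normalising factor\<close>

lemma rho_r_attained:
  assumes "n \<noteq> 1"
  obtains S T where "S \<in> subintervals n" "T \<in> subintervals n"
    "rho_r n p1 p2 = \<bar>real (card (p1 ` S \<inter> T)) - real (card (p2 ` S \<inter> T))\<bar> / real n"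
  using Max_in[OF rho_r_values[of
      "\<lambda>S T. \<bar>real (card (p1 ` S \<inter> T)) - real (card (p2 ` S \<inter> T))\<bar>" n]] assms
  by (auto simp: rho_r_def)

lemma discrepancy_le_rho_r:
  assumes "n \<ge> 2" "S \<in> subintervals n" "T \<in> subintervals n"
  shows "\<bar>real (card (p1 ` S \<inter> T)) - real (card (p2 ` S \<inter> T))\<bar> \<le> real n * rho_r n p1 p2"
proof -
  let ?f = "\<lambda>S T. \<bar>real (card (p1 ` S \<inter> T)) - real (card (p2 ` S \<inter> T))\<bar>"
  have "?f S T \<le> Max {?f S T | S T. S \<in> subintervals n \<and> T \<in> subintervals n}"
    by (rule Max_ge[OF rho_r_values(1)]) (use assms in blast)
  then show ?thesis
    using assms(1) by (simp add: rho_r_def)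
qed

lemma rho_r_nonneg: "0 \<le> rho_r n p1 p2"
proof (cases "n = 1")
  case False
  then show ?thesis
    using rho_r_attained[of n p1 p2] by (metis abs_ge_zero divide_nonneg_nonneg of_nat_0_le_iff)
qed (simp add: rho_r_def)

lemma rho_r_le_1: "rho_r n p1 p2 \<le> 1"
proof (cases "n = 1")
  case False
  then obtain S T where ST: "S \<in> subintervals n" "T \<in> subintervals n"
    "rho_r n p1 p2 = \<bar>real (card (p1 ` S \<inter> T)) - real (card (p2 ` S \<inter> T))\<bar> / real n"
    using rho_r_attained by blast
  have "card (p ` S \<inter> T) \<le> n" for p :: "nat \<Rightarrow> nat"
  proof -
    have "card (p ` S \<inter> T) \<le> card {1..n}"
      using ST(2) by (intro card_mono) (auto simp: subintervals_def)
    then show ?thesis by simp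
  qed
  from this[of p1] this[of p2] show ?thesis
    unfolding ST(3) by (auto simp: divide_le_eq_1)
qed (simp add: rho_r_def)

text \<open>These bounds fix the constants: the upper one turns 1/16 into 1/8 in the lower estimate
  of \<open>rho_EMD\<close>, the lower one turns 3 into 12 in the upper estimate.\<close>

lemma two_choose_bounds:
  assumes "n \<ge> 2"
  shows "real (n choose 2) \<le> (real n)\<^sup>2 / 2" "(real n)\<^sup>2 / 4 \<le> real (n choose 2)"
    "0 < real (n choose 2)"
proof -
  \<comment> \<open>Evenness makes the natural-number division in \<open>choose_two\<close> exact,
    so it can be read as real division.\<close>
  have "even (n * (n - 1))"
    using assms by (cases n) auto
  then have eq: "real (n choose 2) = real n * (real n - 1) / 2"
    using assms by (simp add: choose_two real_of_nat_div of_nat_diff)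
  show "real (n choose 2) \<le> (real n)\<^sup>2 / 2"
    unfolding eq power2_eq_square by (simp add: field_simps)
  have "real n * (real n / 2) \<le> real n * (real n - 1)"
    using assms by (intro mult_left_mono) auto
  then show "(real n)\<^sup>2 / 4 \<le> real (n choose 2)"
    unfolding eq power2_eq_square by simp
  show "0 < real (n choose 2)"
    using assms by simp
qed

section \<open>The two inequalities between the distances\<close>

lemma rho_r_square_le_rho_EMD:
  assumes n: "n \<ge> 2" and p1: "p1 permutes {1..n}" and p2: "p2 permutes {1..n}"
  shows "(rho_r n p1 p2)\<^sup>2 / 8 \<le> rho_EMD n p1 p2"
proof -
  have n1: "n \<noteq> 1"
    using n by simp
  obtain S T where S: "S \<in> subintervals n" and T: "T \<in> subintervals n"
    and r: "rho_r n p1 p2 = \<bar>real (card (p1 ` S \<inter> T)) - real (card (p2 ` S \<inter> T))\<bar> / real n"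
    using rho_r_attained[OF n1] .
  obtain a b c d where ab: "S = {a..b}" "{a..b} \<subseteq> {1..n}" and cd: "T = {c..d}"
    using S T by (auto simp: subintervals_def)
  let ?cost = "\<lambda>\<theta>. \<Sum>i=1..n. \<bar>real i - real (\<theta> i)\<bar> + \<bar>real (p1 i) - real (p2 (\<theta> i))\<bar>"
  have "Min {?cost \<theta> | \<theta>. \<theta> permutes {1..n}} \<in> {?cost \<theta> | \<theta>. \<theta> permutes {1..n}}"
    by (rule Min_in[OF rho_EMD_values])
  then obtain \<theta> where \<theta>: "\<theta> permutes {1..n}"
    and Min: "Min {?cost \<theta> | \<theta>. \<theta> permutes {1..n}} = ?cost \<theta>"
    by blast
  have c1: "card {i \<in> {1..n}. i \<in> {a..b} \<and> p1 i \<in> {c..d}} = card (p1 ` S \<inter> T)"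
  proof -
    have "p1 ` {i \<in> {1..n}. i \<in> {a..b} \<and> p1 i \<in> {c..d}} = p1 ` S \<inter> T"
      using ab(2) unfolding ab(1) cd by blast
    then show ?thesis
      using card_image[OF permutes_inj_on[OF p1], of "{i \<in> {1..n}. i \<in> {a..b} \<and> p1 i \<in> {c..d}}"]
      by simp
  qed
  \<comment> \<open>An optimal \<open>\<theta>\<close> moves the graph point (i,
    \<open>p1 i\<close>) to (\<open>\<theta> i\<close>, \<open>p2 (\<theta> i)\<close>). As
    \<open>\<theta>\<close> maps [n] onto itself, the targets run through the whole graph of
    \<open>p2\<close>.\<close>
  have c2: "card {i \<in> {1..n}. \<theta> i \<in> {a..b} \<and> p2 (\<theta> i) \<in> {c..d}} = card (p2 ` S \<inter> T)"
  proof -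
    have "p2 \<circ> \<theta> permutes {1..n}"
      by (rule permutes_compose[OF \<theta> p2])
    moreover have "(p2 \<circ> \<theta>) ` {i \<in> {1..n}. \<theta> i \<in> {a..b} \<and> p2 (\<theta> i) \<in> {c..d}} = p2 ` S \<inter> T"
    proof -
      have "\<theta> ` {i \<in> {1..n}. \<theta> i \<in> {a..b} \<and> p2 (\<theta> i) \<in> {c..d}}
          = \<theta> ` {1..n} \<inter> {k. k \<in> {a..b} \<and> p2 k \<in> {c..d}}"
        by auto
      also have "\<dots> = {k. k \<in> {a..b} \<and> p2 k \<in> {c..d}}"
        using ab(2) unfolding permutes_image[OF \<theta>] by auto
      finally show ?thesis
        unfolding image_comp[symmetric] ab(1) cd by blast
    qed
    ultimately show ?thesis
      using card_image[OF permutes_inj_on, of "p2 \<circ> \<theta>" "{1..n}"] by metis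
  qed
  have "(real n * rho_r n p1 p2)\<^sup>2 / 16 = (real (card (p1 ` S \<inter> T)) - real (card (p2 ` S \<inter> T)))\<^sup>2 / 16"
    using n by (simp add: r)
  also have "\<dots> \<le> ?cost \<theta>"
    using transport_cost_ge_discrepancy[of "{1..n}" "\<lambda>i. i" p1 \<theta> "p2 \<circ> \<theta>" a b c d]
      permutes_inj_on[OF p1] permutes_inj_on[OF \<theta>]
      permutes_inj_on[OF permutes_compose[OF \<theta> p2]]
    by (simp add: c1[simplified] c2[simplified])
  finally have cost: "(real n * rho_r n p1 p2)\<^sup>2 / 16 \<le> ?cost \<theta>" .
  have "(rho_r n p1 p2)\<^sup>2 / 8 * real (n choose 2) \<le> (rho_r n p1 p2)\<^sup>2 / 8 * ((real n)\<^sup>2 / 2)"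
    using two_choose_bounds(1)[OF n] by (intro mult_left_mono) auto
  also have "\<dots> = (real n * rho_r n p1 p2)\<^sup>2 / 16"
    by (simp add: power_mult_distrib)
  also note cost
  finally have "(rho_r n p1 p2)\<^sup>2 / 8 \<le> ?cost \<theta> / real (n choose 2)"
    using two_choose_bounds(3)[OF n] by (simp add: pos_le_divide_eq)
  then show ?thesis
    using n1 unfolding rho_EMD_def Min by simp
qed

lemma rho_EMD_le_sqrt_rho_r:
  assumes n: "n \<ge> 2" and p1: "p1 permutes {1..n}" and p2: "p2 permutes {1..n}"
  shows "rho_EMD n p1 p2 \<le> 12 * sqrt (rho_r n p1 p2)"
proof -
  define D where "D = real n * rho_r n p1 p2"
  \<comment> \<open>This scale balances the two costs: width \<open>w\<close> costs about
    \<open>n * w\<close> horizontally, and about \<open>n / w\<close> strips cost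
    \<open>n * D\<close> each vertically.\<close>
  define s where "s = sqrt (real n * D)"
  \<comment> \<open>Rounding up this way gives \<open>s \<le> w\<close> while indices in one strip
    still differ by at most \<open>w - 1 \<le> s\<close>. It also keeps \<open>w\<close> positive
    when \<open>s = 0\<close>; the strips are then single points.\<close>
  define w where "w = nat \<lfloor>s\<rfloor> + 1"
  have D0: "0 \<le> D" and Dn: "D \<le> real n"
    using rho_r_nonneg[of n p1 p2] rho_r_le_1[of n p1 p2] by (auto simp: D_def mult_left_le)
  have s0: "0 \<le> s" and s2: "s * s = real n * D"
    using D0 by (simp_all add: s_def)
  \<comment> \<open>This absorbs the extra strip that appears when \<open>w\<close> does not divide
    \<open>n\<close>.\<close>
  have Ds: "D \<le> s"
    unfolding s_def by (rule real_le_rsqrt) (use D0 Dn in \<open>simp add: power2_eq_square mult_right_mono\<close>)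
  have w: "s \<le> real w" "real w - 1 \<le> s" "0 < w"
    using s0 by (auto simp: w_def; linarith)+
  have div_eq: "k div w = j \<longleftrightarrow> j * w \<le> k \<and> k < j * w + w" for j k
  proof -
    have "k div w = j \<longleftrightarrow> j \<le> k div w \<and> k div w < Suc j"
      by auto
    then show ?thesis
      using w(3) by (simp add: less_eq_div_iff_mult_less_eq div_less_iff_less_mult add.commute)
  qed
  \<comment> \<open>The shift by 1 makes the strips blocks of \<open>w\<close> integers starting at
    1, the last one possibly cut off at \<open>n\<close>.\<close>
  define strip where "strip j = {i \<in> {1..n}. (i - 1) div w = j}" for j
  define m where "m = (n - 1) div w + 1"
  have strip_interval: "strip j \<in> subintervals n" for j
  proof -
    have "strip j = {j * w + 1..min n (j * w + w)}"
    proof (rule set_eqI)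
      fix i
      show "i \<in> strip j \<longleftrightarrow> i \<in> {j * w + 1..min n (j * w + w)}"
        unfolding strip_def using div_eq[of "i - 1" j]
        by (cases i) (auto simp: Suc_le_eq less_Suc_eq_le)
    qed
    moreover have "strip j \<subseteq> {1..n}"
      unfolding strip_def by auto
    ultimately show ?thesis
      unfolding subintervals_def by blast
  qed
  have "\<exists>g. bij_betw g (strip j) (strip j) \<and>
      (\<Sum>i\<in>strip j. \<bar>real (p1 i) - real (p2 (g i))\<bar>) \<le> real n * D" for j
  proof -
    have sub: "strip j \<subseteq> {1..n}" and fin: "finite (strip j)"
      unfolding strip_def by auto
    have im: "p ` strip j \<subseteq> {1..n}" if "p permutes {1..n}" for p
      using image_mono[OF sub, of p] permutes_image[OF that] by simp
    \<comment> \<open>Both \<open>strip j\<close> and \<open>{1..t}\<close> are subintervals, so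
      this is the discrepancy of one rectangle.\<close>
    have "\<bar>real (card (p1 ` strip j \<inter> {1..t})) - real (card (p2 ` strip j \<inter> {1..t}))\<bar> \<le> D"
      if "t \<in> {1..n}" for t
      unfolding D_def using that
      by (intro discrepancy_le_rho_r n strip_interval) (auto simp: subintervals_def)
    from monotone_matching[OF fin permutes_inj_on[OF p1] im[OF p1] permutes_inj_on[OF p2] im[OF p2] this]
    show ?thesis
      by blast
  qed
  then obtain g where g: "\<And>j. bij_betw (g j) (strip j) (strip j)"
    and gcost: "\<And>j. (\<Sum>i\<in>strip j. \<bar>real (p1 i) - real (p2 (g j i))\<bar>) \<le> real n * D"
    by metis
  \<comment> \<open>The matchings glue to a permutation because each preserves its own
    strip.\<close>
  define \<theta> where "\<theta> i = (if i \<in> {1..n} then g ((i - 1) div w) i else i)" for i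
  have self: "i \<in> strip ((i - 1) div w)" if "i \<in> {1..n}" for i
    using that by (simp add: strip_def)
  have \<theta>_strip: "\<theta> i \<in> strip ((i - 1) div w)" if "i \<in> {1..n}" for i
    using bij_betwE[OF g] self[OF that] that by (simp add: \<theta>_def)
  have \<theta>: "\<theta> permutes {1..n}"
  proof (rule inj_imp_permutes)
    show "inj_on \<theta> {1..n}"
    proof (rule inj_onI)
      fix i k assume i: "i \<in> {1..n}" and k: "k \<in> {1..n}" and eq: "\<theta> i = \<theta> k"
      have same: "(i - 1) div w = (k - 1) div w"
        using \<theta>_strip[OF i] \<theta>_strip[OF k] eq by (simp add: strip_def)
      then have "g ((i - 1) div w) i = g ((i - 1) div w) k"
        using eq i k by (simp add: \<theta>_def)
      then show "i = k"
        using bij_betw_imp_inj_on[OF g] self[OF i] self[OF k] same by (metis inj_onD)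
    qed
    show "\<theta> i \<in> {1..n}" if "i \<in> {1..n}" for i
      using \<theta>_strip[OF that] by (simp add: strip_def)
  qed (auto simp: \<theta>_def)
  have "\<bar>real i - real (\<theta> i)\<bar> \<le> s" if "i \<in> {1..n}" for i
  proof -
    have ge: "1 \<le> \<theta> i" "1 \<le> i" and q: "(\<theta> i - 1) div w = (i - 1) div w"
      using \<theta>_strip[OF that] that by (auto simp: strip_def)
    have "i - 1 < \<theta> i - 1 + w" "\<theta> i - 1 < i - 1 + w"
      using q div_eq[of "i - 1" "(i - 1) div w"] div_eq[of "\<theta> i - 1" "(i - 1) div w"]
      by linarith+
    then have "\<bar>real i - real (\<theta> i)\<bar> \<le> real w - 1"
      using ge by linarith
    then show ?thesis
      using w(2) by linarith
  qed
  then have hor: "(\<Sum>i=1..n. \<bar>real i - real (\<theta> i)\<bar>) \<le> real n * s"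
    using sum_bounded_above[of "{1..n}" "\<lambda>i. \<bar>real i - real (\<theta> i)\<bar>" s] by simp
  have "(\<Sum>i=1..n. \<bar>real (p1 i) - real (p2 (\<theta> i))\<bar>)
      = (\<Sum>j<m. \<Sum>i\<in>strip j. \<bar>real (p1 i) - real (p2 (\<theta> i))\<bar>)"
    unfolding strip_def m_def
    by (rule sum.group[symmetric]) (auto simp: less_Suc_eq_le intro!: div_le_mono)
  also have "\<dots> = (\<Sum>j<m. \<Sum>i\<in>strip j. \<bar>real (p1 i) - real (p2 (g j i))\<bar>)"
    by (intro sum.cong) (auto simp: strip_def \<theta>_def)
  also have "\<dots> \<le> real m * (real n * D)"
    using sum_bounded_above[of "{..<m}", OF gcost] by simp
  also have "\<dots> \<le> real n * (2 * s)"
  proof -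
    have "real m \<le> real n / real w + 1"
    proof -
      have "real ((n - 1) div w) \<le> real (n - 1) / real w"
        by (rule of_nat_div_le_of_nat)
      also have "\<dots> \<le> real n / real w"
        by (intro divide_right_mono) auto
      finally show ?thesis
        by (simp add: m_def)
    qed
    then have "real m * D \<le> (real n / real w + 1) * D"
      using D0 by (rule mult_right_mono)
    \<comment> \<open>The first term is at most \<open>s\<close> because \<open>s \<le> w\<close>;
      the second, from the rounding in \<open>m\<close>, is at most \<open>s\<close> by
      \<open>Ds\<close>.\<close>
    also have "\<dots> = s * s / real w + D"
      by (simp add: s2 algebra_simps)
    also have "\<dots> \<le> s + s"
    proof (rule add_mono)
      have "s * s \<le> s * real w"
        using w(1) s0 by (rule mult_left_mono)
      then show "s * s / real w \<le> s"
        using w(3) by (simp add: pos_divide_le_eq)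
    qed (fact Ds)
    finally have "real n * (real m * D) \<le> real n * (2 * s)"
      by (intro mult_left_mono) auto
    then show ?thesis
      by (simp add: mult_ac)
  qed
  finally have ver: "(\<Sum>i=1..n. \<bar>real (p1 i) - real (p2 (\<theta> i))\<bar>) \<le> real n * (2 * s)" .
  let ?cost = "\<lambda>\<theta>. \<Sum>i=1..n. \<bar>real i - real (\<theta> i)\<bar> + \<bar>real (p1 i) - real (p2 (\<theta> i))\<bar>"
  have "Min {?cost \<theta> | \<theta>. \<theta> permutes {1..n}} \<le> ?cost \<theta>"
    by (rule Min_le[OF rho_EMD_values(1)]) (use \<theta> in blast)
  \<comment> \<open>One share of \<open>n * s\<close> is horizontal, two are vertical.\<close>
  also have "\<dots> \<le> 3 * (real n * s)"
    using hor ver by (simp add: sum.distrib)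
  also have "s = real n * sqrt (rho_r n p1 p2)"
    by (simp add: s_def D_def real_sqrt_mult)
  also have "3 * (real n * (real n * sqrt (rho_r n p1 p2)))
      = 12 * sqrt (rho_r n p1 p2) * ((real n)\<^sup>2 / 4)"
    by (simp add: power2_eq_square)
  also have "\<dots> \<le> 12 * sqrt (rho_r n p1 p2) * real (n choose 2)"
    using two_choose_bounds(2)[OF n] rho_r_nonneg by (intro mult_left_mono) auto
  finally show ?thesis
    using n two_choose_bounds(3)[OF n] by (simp add: rho_EMD_def pos_divide_le_eq)
qed

theorem theorem1p4:
  fixes n :: nat and p1 p2 :: "nat \<Rightarrow> nat"
  assumes "n \<ge> 1" and "p1 permutes {1..n}" and "p2 permutes {1..n}"
  shows "1 / 8 * (rho_r n p1 p2)^2 \<le> rho_EMD n p1 p2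
       \<and> rho_EMD n p1 p2 \<le> 48 * sqrt (rho_r n p1 p2)"
proof (cases "n = 1")
  case True
  then show ?thesis
    by (simp add: rho_r_def rho_EMD_def)
next
  case False
  then have n: "n \<ge> 2"
    using assms(1) by simp
  \<comment> \<open>Nonnegativity lets the constant 12 be weakened to 48.\<close>
  have "0 \<le> sqrt (rho_r n p1 p2)"
    using rho_r_nonneg by simp
  then show ?thesis
    using rho_r_square_le_rho_EMD[OF n assms(2,3)] rho_EMD_le_sqrt_rho_r[OF n assms(2,3)]
    by linarith
qed

end
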